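(* For every integer $n\ge1$, $$\left\lfloor\left(\sum_{k=n}^\infty\frac{(-1)^k}{B_{2k}}\right)^{-1}\right\rfloor=\begin{cases}B_{2n}+B_{2n-2}&\text{if $n$ is even},\\ -(B_{2n}+B_{2n-2}+1)&\text{if $n$ is odd}.\end{cases}$$
   Context: The balancing numbers are defined by $B_0=0$, $B_1=1$, $B_n=6B_{n-1}-B_{n-2}$ for $n\ge 2$. $\lfloor x\rfloor$ denotes the floor of a real number $x$. *)

theory Defs
  imports Complex_Main
begin

fun balancing :: "nat \<Rightarrow> int" where
  "balancing 0 = 0"
| "balancing (Suc 0) = 1"
| "balancing (Suc (Suc n)) = 6 * balancing (Suc n) - balancing n"

end

theory Submission
  imports Defs
begin

text \<open>
  Write \<open>b k\<close> for the \<open>2k\<close>-th balancing number, so that \<open>b (k+2) = 34 b (k+1) - b k\<close>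
  and \<open>b (k+1)\<^sup>2 - b k * b (k+2) = 36\<close>, and put \<open>X k = b k + b (k+1)\<close>. The Cassini identity gives
  \<open>1 / X k + 1 / X (k+1) - 1 / b (k+1) = 36 / (b (k+1) * X k * X (k+1))\<close>.
  Summing with alternating signs, the left-hand side telescopes, and the Leibniz bounds for the
  right-hand side place the alternating sum of the \<open>1 / b\<close> strictly between
  \<open>1 / (X + 1)\<close> and \<open>1 / X\<close>.
\<close>

definition even_balancing :: "nat \<Rightarrow> int" where
  "even_balancing k = balancing (2 * k)"

lemma even_balancing_0 [simp]: "even_balancing 0 = 0"
  by (simp add: even_balancing_def)

lemma even_balancing_1 [simp]: "even_balancing (Suc 0) = 6"
  by (simp add: even_balancing_def numeral_2_eq_2)

text \<open>The characteristic roots of the balancing recurrence are \<open>r\<close> and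
  \<open>1/r\<close> with sum 6; taking every second term squares them, and
  \<open>r^2 + 1/r^2 = 6^2 - 2 = 34\<close>.\<close>

lemma even_balancing_rec [simp]:
  "even_balancing (Suc (Suc k)) = 34 * even_balancing (Suc k) - even_balancing k"
  by (cases k) (simp_all add: even_balancing_def numeral_2_eq_2)

lemma even_balancing_growth:
  "0 \<le> even_balancing k \<and> even_balancing k + 6 \<le> even_balancing (Suc k)"
  by (induction k) auto

text \<open>The recurrence has trailing coefficient -1, so this expression does not change with
  \<open>k\<close>; at \<open>k = 0\<close> it is \<open>6^2 - 0\<close>.\<close>

lemma even_balancing_cassini:
  "even_balancing (Suc k) ^ 2 - even_balancing k * even_balancing (Suc (Suc k)) = 36"
  by (induction k) (auto simp: algebra_simps power2_eq_square)

lemma even_balancing_ge: "int k \<le> even_balancing k"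
proof (induction k)
  case (Suc k)
  then show ?case using even_balancing_growth[of k] by simp
qed simp

lemma inverse_at_top_tendsto_0:
  fixes f :: "nat \<Rightarrow> real"
  assumes "\<And>n. real n \<le> f n"
  shows "(\<lambda>n. 1 / f n) \<longlonglongrightarrow> 0"
proof -
  have "filterlim f at_top sequentially"
    by (rule filterlim_at_top_mono[OF filterlim_real_sequentially]) (simp add: assms)
  then show ?thesis
    by (auto intro!: tendsto_divide_0[OF tendsto_const] filterlim_at_top_imp_at_infinity)
qed

text \<open>With \<open>g j = (-1)^j * f j\<close>, each term equals
  \<open>g j - g (Suc j)\<close>.\<close>

lemma alternating_telescope_sums:
  fixes f :: "nat \<Rightarrow> real"
  assumes "f \<longlonglongrightarrow> 0"
  shows "(\<lambda>j. (-1) ^ j * (f j + f (Suc j))) sums f 0"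
proof -
  have "(\<lambda>n. (-1) ^ n * f n) \<longlonglongrightarrow> 0"
    using assms by (rule tendsto_0_le[where K = 1]) (simp add: abs_mult)
  from telescope_sums'[OF this] show ?thesis by (simp add: algebra_simps)
qed

text \<open>This is the tail from index \<open>n = Suc m\<close>, with the sign normalised to start
  with a plus; the shift keeps the zero \<open>even_balancing 0\<close> out of the
  denominators.\<close>

definition even_balancing_sum :: "nat \<Rightarrow> real" where
  "even_balancing_sum m = (\<Sum>j. (-1) ^ j * (1 / even_balancing (Suc (m + j))))"

lemma even_balancing_sums:
  "(\<lambda>j. (-1) ^ j * (1 / even_balancing (Suc (m + j)))) sums even_balancing_sum m"
proof -
  have "(\<lambda>j. 1 / real_of_int (even_balancing j)) \<longlonglongrightarrow> 0"
  proof (rule inverse_at_top_tendsto_0)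
    show "real j \<le> real_of_int (even_balancing j)" for j
      using even_balancing_ge[of j] by linarith
  qed
  from LIMSEQ_ignore_initial_segment[OF this, of "Suc m"]
  have "(\<lambda>j. 1 / real_of_int (even_balancing (Suc (m + j)))) \<longlonglongrightarrow> 0"
    by (simp add: add.commute)
  moreover have "monoseq (\<lambda>j. 1 / real_of_int (even_balancing (Suc (m + j))))"
  proof (intro decseq_imp_monoseq decseq_SucI divide_left_mono)
    fix j
    note growth = even_balancing_growth[of "m + j"] even_balancing_growth[of "Suc (m + j)"]
    then show "real_of_int (even_balancing (Suc (m + j))) \<le> even_balancing (Suc (m + Suc j))"
      by simp
    show "0 < real_of_int (even_balancing (Suc (m + Suc j))) * even_balancing (Suc (m + j))"
      using growth by (intro mult_pos_pos) (simp_all only: of_int_0_less_iff add_Suc_right, linarith+)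
  qed simp
  ultimately show ?thesis
    unfolding even_balancing_sum_def by (intro summable_sums summable_Leibniz(1))
qed

lemma even_balancing_sum_bounds:
  fixes m :: nat
  defines "x \<equiv> real_of_int (even_balancing (Suc m) + even_balancing m)"
  shows "1 / (x + 1) < even_balancing_sum m" "even_balancing_sum m < 1 / x"
proof -
  define b where "b k = real_of_int (even_balancing (m + k))" for k
  define X where "X k = b (Suc k) + b k" for k
  define d where "d k = 36 / (b (Suc k) * X k * X (Suc k))" for k
  have rec: "b (Suc (Suc k)) = 34 * b (Suc k) - b k" for k by (simp add: b_def)
  have b0: "0 \<le> b k" and bS: "b k + 6 \<le> b (Suc k)" for k
    using even_balancing_growth[of "m + k"] by (simp_all add: b_def flip: of_int_add)
  have b6: "6 \<le> b (Suc k)" for k using b0[of k] bS[of k] by simp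
  have cassini: "b (Suc k) ^ 2 - b k * b (Suc (Suc k)) = 36" for k
    using arg_cong[OF even_balancing_cassini[of "m + k"], of real_of_int] by (simp add: b_def)
  have bge: "real k \<le> b k" for k
  proof -
    have "int k \<le> even_balancing (m + k)" using even_balancing_ge[of "m + k"] by simp
    then show ?thesis unfolding b_def by linarith
  qed
  have Xpos: "0 < X k" and XS: "X k \<le> X (Suc k)" and Xge: "b (Suc k) \<le> X k" for k
    using b0[of k] b6[of k] bS[of k] bS[of "Suc k"] by (simp_all add: X_def)
  have bpos: "0 < b (Suc k)" for k using b6[of k] by simp
  have dpos: "0 < d k" for k using bpos Xpos by (simp add: d_def)
  have ddec: "d (Suc k) < d k" for k
  proof -
    have "b (Suc k) * X k * X (Suc k) < b (Suc (Suc k)) * X (Suc k) * X (Suc (Suc k))"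
      using bpos[of k] Xpos[of k] Xpos[of "Suc k"] XS bS[of "Suc k"] Xpos[of "Suc (Suc k)"]
      by (intro mult_less_le_imp_less) (auto intro!: mult_strict_right_mono mult_less_le_imp_less)
    then show ?thesis
      unfolding d_def using bpos Xpos by (intro divide_strict_left_mono) (auto intro!: mult_pos_pos)
  qed
  have d_eq: "1 / X k + 1 / X (Suc k) - 1 / b (Suc k) = d k" for k
  proof -
    \<comment> \<open>Writing p, q, r for three consecutive values of \<open>b\<close>, (p + 2q +
      r)q - (p + q)(q + r) collapses to q^2 - pr, the Cassini expression.\<close>
    have "(X k + X (Suc k)) * b (Suc k) - X k * X (Suc k) = 36"
      using cassini[of k] by (simp add: X_def algebra_simps power2_eq_square)
    then show ?thesis
      using Xpos[of k] Xpos[of "Suc k"] bpos[of k] unfolding d_def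
      by (simp add: divide_simps) (simp add: algebra_simps)
  qed
  have invb: "(\<lambda>k. 1 / b (Suc k)) \<longlonglongrightarrow> 0"
    by (rule LIMSEQ_Suc[OF inverse_at_top_tendsto_0[OF bge]])
  have invX: "(\<lambda>k. 1 / X k) \<longlonglongrightarrow> 0"
  proof (rule inverse_at_top_tendsto_0)
    fix k show "real k \<le> X k" using bge[of "Suc k"] Xge[of k] by simp
  qed
  have "(\<lambda>j. (-1) ^ j * (1 / b (Suc j))) sums even_balancing_sum m"
    using even_balancing_sums[of m] by (simp add: b_def)
  from sums_diff[OF alternating_telescope_sums[OF invX] this]
  have d_sums: "(\<lambda>j. (-1) ^ j * d j) sums (1 / X 0 - even_balancing_sum m)"
    by (simp only: d_eq flip: right_diff_distrib)
  have "(\<lambda>k. 1 / X k + 1 / X (Suc k) - 1 / b (Suc k)) \<longlonglongrightarrow> 0 + 0 - 0"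
    by (intro tendsto_intros invX LIMSEQ_Suc[OF invX] invb)
  then have d0: "d \<longlonglongrightarrow> 0" by (simp add: d_eq)
  have dm: "monoseq d"
    using ddec by (intro decseq_imp_monoseq decseq_SucI less_imp_le)
  have "(\<Sum>j. (-1) ^ j * d j) \<in> {\<Sum>i<2 * k. (-1) ^ i * d i..\<Sum>i<2 * k + 1. (-1) ^ i * d i}" for k
    using summable_Leibniz(2)[OF d0 dm] dpos[of 0] by blast
  \<comment> \<open>The upper bound comes from \<open>k = 0\<close>, the lower one from
    \<open>k = 1\<close>. Since \<open>d 1 < d 0\<close>, the latter makes the difference strictly
    positive.\<close>
  from this[of 0] this[of 1]
  have "d 0 - d 1 \<le> 1 / X 0 - even_balancing_sum m" "1 / X 0 - even_balancing_sum m \<le> d 0"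
    using sums_unique[OF d_sums] by (simp_all add: numeral_2_eq_2)
  \<comment> \<open>After clearing denominators this reads
    \<open>36 * (X 0 + 1) < b 1 * X 1\<close>. The right side is at least \<open>204 * b 1\<close>,
    whereas \<open>b 0 + 6 \<le> b 1\<close> bounds the left side by
    \<open>72 * b 1\<close>.\<close>
  moreover have "d 0 < 1 / X 0 - 1 / (X 0 + 1)"
  proof -
    have "b 1 * 34 \<le> X 1" using bS[of 0] rec[of 0] by (simp add: X_def)
    then have "6 * (b 1 * 34) \<le> b 1 * X 1"
      using b6[of 0] by (intro mult_mono) auto
    moreover have "36 * (X 0 + 1) < 6 * (b 1 * 34)"
      using b6[of 0] bS[of 0] by (simp add: X_def)
    ultimately have "36 * (X 0 + 1) < b 1 * X 1" by linarith
    then show ?thesis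
      using Xpos[of 0] Xpos[of 1] bpos[of 0]
      by (simp add: d_def divide_simps)
  qed
  moreover have "X 0 = x" by (simp add: X_def b_def x_def)
  ultimately show "1 / (x + 1) < even_balancing_sum m" "even_balancing_sum m < 1 / x"
    using ddec[of 0] by auto
qed

theorem theorem7:
  fixes n :: nat
  assumes "n \<ge> 1"
  shows "\<lfloor>inverse (\<Sum>j. (-1) ^ (n + j) / real_of_int (balancing (2 * (n + j))))\<rfloor> =
    (if even n then balancing (2 * n) + balancing (2 * n - 2)
     else - (balancing (2 * n) + balancing (2 * n - 2) + 1))"
proof -
  obtain m where m: "n = Suc m" using assms by (cases n) auto
  define x where "x = even_balancing (Suc m) + even_balancing m"
  define s where "s = even_balancing_sum m"
  have x: "balancing (2 * n) + balancing (2 * n - 2) = x"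
    by (simp add: m x_def even_balancing_def)
  have xpos: "0 < x" using even_balancing_growth[of m] by (simp add: x_def)
  have bounds: "1 / (real_of_int x + 1) < s" "s < 1 / real_of_int x"
    using even_balancing_sum_bounds[of m] by (simp_all add: x_def s_def)
  have spos: "0 < s" using xpos by (intro less_trans[OF _ bounds(1)]) simp
  have inv: "real_of_int x < inverse s" "inverse s < real_of_int x + 1"
    using bounds xpos spos by (simp_all add: field_simps)
  have "(\<Sum>j. (-1) ^ (n + j) / real_of_int (balancing (2 * (n + j)))) = (-1) ^ n * s"
    using sums_unique[OF sums_mult[OF even_balancing_sums[of m], of "(-1) ^ n"]]
    by (simp add: s_def m even_balancing_def power_add del: balancing.simps)
  \<comment> \<open>For odd \<open>n\<close> the inverse is \<open>- inverse s\<close>, strictly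
    between \<open>-(x + 1)\<close> and \<open>-x\<close>; strictness at \<open>-x\<close> is what
    makes the floor \<open>-(x + 1)\<close>.\<close>
  then show ?thesis
    unfolding x using inv by (cases "even n") (auto intro!: floor_unique)
qed

end
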